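(* Let $P_1, P_2 \in \mathcal{D}_{\geq 1} \cap M$ be discrete, with probability mass functions $f, g$, respectively (i.e. $f(x) = P_1(\{x\})$, $g(x) = P_2(\{x\})$). (1) If there is some $x_0 \geq 1$ such that $f(x_0) < g(x_0)$ and $f(x) \leq g(x)$ for all $x > x_0$, then $P_1 \prec_{\text{tail}} P_2$. (2) If $P_1$ and $P_2$ both have finite support, then $$P_1 \prec_{\text{tail}} P_2 \iff \exists x_0 \geq 1:\ f(x_0) < g(x_0) \text{ and } \forall x > x_0:\ f(x) \leq g(x).$$
   Context: $\mathcal{D}$ is the set of Borel probability measures on $\mathbb{R}$; $\mathcal{D}_{\geq 1}$ is the subset of those whose support is contained in $[1,\infty)$. A measure $P \in \mathcal{D}$ is discrete if $P(S)=1$ for some countable set $S$. $M$ is the set of $P \in \mathcal{D}$ with $\int |x|^k \, dP(x) < \infty$ for all $k \in \mathbb{N}$; for $P\in M$ and $k \in \mathbb{N}_0$ let $m_k(P) = \int x^k \, dP(x)$. The stochastic tail order on $\mathcal{D}$ is defined by: $P_1 \preccurlyeq_{\text{tail}} P_2$ iff $P_1 = P_2$, or ($P_1, P_2 \in M$ and $m_k(P_1) \leq m_k(P_2)$ for all but finitely many $k \in \mathbb{N}_0$). $P_1 \prec_{\text{tail}} P_2$ means $P_1 \preccurlyeq_{\text{tail}} P_2$ and not $P_2 \preccurlyeq_{\text{tail}} P_1$. *)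

theory Defs
  imports "HOL-Probability.Probability"
begin

definition prob_dists :: "real measure set" where
  "prob_dists = {P. real_distribution P}"

text \<open>The (closed) topological support: every open neighbourhood has positive mass.\<close>

definition supp :: "real measure \<Rightarrow> real set" where
  "supp P = {x. \<forall>U. open U \<longrightarrow> x \<in> U \<longrightarrow> measure P U > 0}"

definition prob_dists_ge1 :: "real measure set" where
  "prob_dists_ge1 = {P \<in> prob_dists. supp P \<subseteq> {1..}}"

text \<open>A countable set of reals is Borel, so no measurability condition on \<open>S\<close> is needed.\<close>

definition discrete_dist :: "real measure \<Rightarrow> bool" where
  "discrete_dist P \<longleftrightarrow> (\<exists>S. countable S \<and> measure P S = 1)"

definition finite_moment_dists :: "real measure set" where
  "finite_moment_dists = {P \<in> prob_dists. \<forall>k::nat. integrable P (\<lambda>x. \<bar>x\<bar> ^ k)}"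

definition moment :: "nat \<Rightarrow> real measure \<Rightarrow> real" where
  "moment k P = (\<integral>x. x ^ k \<partial>P)"

definition tail_le :: "real measure \<Rightarrow> real measure \<Rightarrow> bool" where
  "tail_le P1 P2 \<longleftrightarrow> P1 = P2 \<or>
     (P1 \<in> finite_moment_dists \<and> P2 \<in> finite_moment_dists \<and>
      (MOST k. moment k P1 \<le> moment k P2))"

definition tail_less :: "real measure \<Rightarrow> real measure \<Rightarrow> bool" where
  "tail_less P1 P2 \<longleftrightarrow> tail_le P1 P2 \<and> \<not> tail_le P2 P1"

end

theory Submission
  imports Defs
begin

text \<open>
  After division by \<open>x0 ^ k\<close>, the \<open>k\<close>-th moment splits into the parts below, at and above \<open>x0\<close>.
  Above \<open>x0\<close> the measure \<open>P1\<close> is dominated by \<open>P2\<close>; at \<open>x0\<close> the difference is the positive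
  constant \<open>g x0 - f x0\<close>; below \<open>x0\<close> the contribution of \<open>P1\<close> tends to \<open>0\<close> by dominated
  convergence. Hence \<open>P1\<close> eventually has strictly smaller moments. For finite supports the
  largest atom at which \<open>f\<close> and \<open>g\<close> differ decides the order, by the first part applied in one
  direction or the other.
\<close>

section \<open>Discrete distributions: support, atoms and comparison of measures\<close>

lemma (in real_distribution) AE_discrete:
  assumes "countable S" "measure M S = 1"
  shows "AE x in M. x \<in> S"
proof -
  have "S \<in> sets M"
    using assms(1) by (simp add: sets.countable)
  then show ?thesis
    using prob_eq_1 assms(2) by blast
qed

text \<open>A point outside the support lies in an open null set, so it is null itself. Since a
  countable \<open>S\<close> carries all the mass, only the countably many points of
  \<open>S - supp M\<close> have to be avoided.\<close>

lemma (in real_distribution) AE_in_supp_discrete: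
  assumes "discrete_dist M"
  shows "AE x in M. x \<in> supp M"
proof -
  obtain S where S: "countable S" "measure M S = 1"
    using assms unfolding discrete_dist_def by blast
  have "AE x in M. x \<noteq> y" if "y \<notin> supp M" for y
  proof -
    from that obtain U where U: "open U" "y \<in> U" "measure M U = 0"
      unfolding supp_def by (auto simp: zero_less_measure_iff)
    have "measure M {y} \<le> measure M U"
      using U by (intro finite_measure_mono) auto
    then have "measure M {y} = 0"
      using U(3) measure_nonneg[of M "{y}"] by linarith
    then have "{y} \<in> null_sets M"
      by (simp add: null_sets_def emeasure_eq_measure)
    then show ?thesis
      by (auto dest: AE_not_in)
  qed
  then have "AE x in M. \<forall>y\<in>S - supp M. x \<noteq> y"
    using S(1) by (subst AE_ball_countable) auto
  then show ?thesis
    using AE_discrete[OF S] by eventually_elim auto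
qed

lemma (in real_distribution) atom_in_supp:
  assumes "measure M {x} \<noteq> 0"
  shows "x \<in> supp M"
  unfolding supp_def
proof safe
  fix U :: "real set" assume "open U" "x \<in> U"
  then have "measure M {x} \<le> measure M U"
    by (intro finite_measure_mono) auto
  then show "0 < measure M U"
    using assms measure_nonneg[of M "{x}"] by linarith
qed

text \<open>Up to a \<open>P\<close>-null set, \<open>A\<close> is the countable set
  \<open>A \<inter> S\<close>, on which both measures are sums over atoms. The rest of
  \<open>A\<close> can only add mass on the side of \<open>Q\<close>.\<close>

lemma emeasure_le_if_atoms_le:
  fixes P Q :: "real measure"
  assumes "real_distribution P" "real_distribution Q" "discrete_dist P"
    and A: "A \<in> sets borel"
    and le: "\<And>x. x \<in> A \<Longrightarrow> measure P {x} \<le> measure Q {x}"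
  shows "emeasure P A \<le> emeasure Q A"
proof -
  interpret P: real_distribution P by fact
  interpret Q: real_distribution Q by fact
  obtain S where S: "countable S" "measure P S = 1"
    using \<open>discrete_dist P\<close> unfolding discrete_dist_def by blast
  have countable: "countable (A \<inter> S)"
    using S(1) by blast
  then have [measurable]: "A \<inter> S \<in> sets borel"
    by (simp add: sets.countable)
  have "emeasure P A = emeasure P (A \<inter> S)"
    using P.AE_discrete[OF S] A by (intro emeasure_eq_AE) (auto elim: eventually_mono)
  also have "\<dots> = (\<integral>\<^sup>+x. emeasure P {x} \<partial>count_space (A \<inter> S))"
    using countable by (intro emeasure_countable_singleton) auto
  also have "\<dots> \<le> (\<integral>\<^sup>+x. emeasure Q {x} \<partial>count_space (A \<inter> S))"
    using le by (intro nn_integral_mono) (auto simp: P.emeasure_eq_measure Q.emeasure_eq_measure)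
  also have "\<dots> = emeasure Q (A \<inter> S)"
    using countable by (intro emeasure_countable_singleton[symmetric]) auto
  also have "\<dots> \<le> emeasure Q A"
    using A by (intro emeasure_mono) auto
  finally show ?thesis .
qed

lemma discrete_dist_eqI:
  assumes "real_distribution P" "real_distribution Q" "discrete_dist P" "discrete_dist Q"
    and "\<And>x. measure P {x} = measure Q {x}"
  shows "P = Q"
proof (rule measure_eqI)
  interpret P: real_distribution P by fact
  interpret Q: real_distribution Q by fact
  show "sets P = sets Q" by simp
  show "emeasure P A = emeasure Q A" if "A \<in> sets P" for A
    using that assms by (intro antisym emeasure_le_if_atoms_le) auto
qed

text \<open>The measures are comparable only inside \<open>A\<close>. Passing to the densities
  \<open>indicator A\<close> makes them comparable on all sets, and then integration is monotone in
  the measure.\<close>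

lemma nn_integral_indicator_mono_measure:
  assumes sets: "sets M = sets N" and A: "A \<in> sets M" and h: "h \<in> borel_measurable M"
    and le: "\<And>B. B \<in> sets M \<Longrightarrow> B \<subseteq> A \<Longrightarrow> emeasure M B \<le> emeasure N B"
  shows "(\<integral>\<^sup>+x. indicator A x * h x \<partial>M) \<le> (\<integral>\<^sup>+x. indicator A x * h x \<partial>N)"
proof -
  have AN: "A \<in> sets N" and hN: "h \<in> borel_measurable N"
    using A h sets by (auto cong: measurable_cong_sets)
  have "density M (indicator A) \<le> density N (indicator A)"
  proof (rule le_measure[THEN iffD2, rule_format])
    show "sets (density M (indicator A)) = sets (density N (indicator A))"
      using sets by simp
    fix B assume "B \<in> sets (density M (indicator A))"
    then have B: "B \<in> sets M" by simp
    then have "emeasure M (A \<inter> B) \<le> emeasure N (A \<inter> B)"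
      using A by (intro le) auto
    then show "emeasure (density M (indicator A)) B \<le> emeasure (density N (indicator A)) B"
      using A AN B sets by (simp add: emeasure_density flip: indicator_inter_arith)
  qed
  then have "nn_integral (density M (indicator A)) h \<le> nn_integral (density N (indicator A)) h"
    using sets by (intro nn_integral_mono_measure) auto
  then show ?thesis
    using A AN h hN by (simp add: nn_integral_density)
qed

section \<open>Integrals of powers of \<open>x / c\<close> above, below and around
  \<open>c\<close>\<close>

lemma power_integral_above_le:
  fixes P Q :: "real measure"
  assumes "real_distribution P" "real_distribution Q" "discrete_dist P"
    and int: "integrable Q (\<lambda>x. (x / c) ^ k)" and c: "0 < c"
    and le: "\<And>x. c < x \<Longrightarrow> measure P {x} \<le> measure Q {x}"
  shows "(\<integral>x. indicator {c<..} x * (x / c) ^ k \<partial>P) \<le> (\<integral>x. indicator {c<..} x * (x / c) ^ k \<partial>Q)"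
proof -
  interpret P: real_distribution P by fact
  interpret Q: real_distribution Q by fact
  let ?u = "\<lambda>x::real. indicator {c<..} x * (x / c) ^ k"
  have nonneg: "0 \<le> ?u x" for x
    using c by (auto simp: indicator_def)
  have u: "ennreal (?u x) = indicator {c<..} x * ennreal ((x / c) ^ k)" for x
    by (auto simp: indicator_def)
  \<comment> \<open>Domination of atoms above \<open>c\<close> passes to all Borel subsets of
    \<open>{c<..}\<close>, hence to nonnegative integrals over it.\<close>
  have le': "(\<integral>\<^sup>+x. ?u x \<partial>P) \<le> (\<integral>\<^sup>+x. ?u x \<partial>Q)"
    unfolding u
    using assms by (intro nn_integral_indicator_mono_measure emeasure_le_if_atoms_le) auto
  have "integrable Q ?u"
    by (rule Bochner_Integration.integrable_bound[OF int]) (auto simp: indicator_def)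
  \<comment> \<open>\<open>enn2real\<close> sends \<infinity> to 0, so it preserves the inequality
    only when the larger side is finite.\<close>
  then have "(\<integral>\<^sup>+x. ?u x \<partial>Q) < \<infinity>"
    using nonneg by (simp add: nn_integral_eq_integral)
  then have "enn2real (\<integral>\<^sup>+x. ?u x \<partial>P) \<le> enn2real (\<integral>\<^sup>+x. ?u x \<partial>Q)"
    using le' by (intro enn2real_mono) auto
  then show ?thesis
    using nonneg by (simp add: integral_eq_nn_integral)
qed

text \<open>For \<open>1 \<le> x < c\<close> the ratio \<open>x / c\<close> lies strictly between 0
  and 1, so its powers tend to 0 and are dominated by the constant 1.\<close>

lemma (in real_distribution) power_integral_below_tendsto_0:
  assumes "AE x in M. 1 \<le> x" and c: "0 < c"
  shows "(\<lambda>k. \<integral>x. indicator {..<c} x * (x / c) ^ k \<partial>M) \<longlonglongrightarrow> 0"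
proof -
  have "(\<lambda>k. \<integral>x. indicator {..<c} x * (x / c) ^ k \<partial>M) \<longlonglongrightarrow> (\<integral>x. 0 \<partial>M)"
  proof (rule integral_dominated_convergence[where w = "\<lambda>_. 1"])
    show "AE x in M. (\<lambda>k. indicator {..<c} x * (x / c) ^ k) \<longlonglongrightarrow> 0"
      using assms(1)
    proof eventually_elim
      case (elim x)
      then show ?case
        using c LIMSEQ_power_zero[of "x / c"] by (cases "x < c") (auto simp: divide_simps)
    qed
    show "AE x in M. norm (indicator {..<c} x * (x / c) ^ k) \<le> 1" for k
      using assms(1)
    proof eventually_elim
      case (elim x)
      then show ?case
        using c by (auto simp: indicator_def intro!: power_le_one)
    qed
  qed auto
  then show ?thesis by simp
qed

lemma (in real_distribution) integral_power_split:
  assumes int: "integrable M (\<lambda>x. (x / c) ^ k)" and c: "0 < c"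
  shows "(\<integral>x. (x / c) ^ k \<partial>M) = (\<integral>x. indicator {..<c} x * (x / c) ^ k \<partial>M) + measure M {c}
    + (\<integral>x. indicator {c<..} x * (x / c) ^ k \<partial>M)"
proof -
  \<comment> \<open>At \<open>x = c\<close> the power is 1 for every \<open>k\<close>, so the middle
    part integrates to the mass of \<open>{c}\<close>, independently of \<open>k\<close>.\<close>
  have eq: "(x / c) ^ k = indicator {..<c} x * (x / c) ^ k + indicator {c} x
      + indicator {c<..} x * (x / c) ^ k" for x
    using c by (auto simp: indicator_def)
  have restr: "integrable M (\<lambda>x. indicator A x * (x / c) ^ k)" if "A \<in> sets borel" for A
    by (rule Bochner_Integration.integrable_bound[OF int]) (use that in \<open>auto simp: indicator_def\<close>)
  have pt: "integrable M (indicat_real {c})"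
    by (simp add: emeasure_eq_measure)
  show ?thesis
    by (subst eq) (simp add: restr pt)
qed

section \<open>Comparison of moments and the tail order\<close>

lemma moment_eventually_less:
  fixes P Q :: "real measure"
  assumes P: "P \<in> prob_dists_ge1 \<inter> finite_moment_dists" "discrete_dist P"
    and Q: "Q \<in> prob_dists_ge1 \<inter> finite_moment_dists" "discrete_dist Q"
    and c: "0 < c" and less: "measure P {c} < measure Q {c}"
    and le: "\<And>x. c < x \<Longrightarrow> measure P {x} \<le> measure Q {x}"
  shows "\<forall>\<^sub>F k in sequentially. moment k P < moment k Q"
proof -
  interpret P: real_distribution P
    using P by (simp add: prob_dists_ge1_def prob_dists_def)
  interpret Q: real_distribution Q
    using Q by (simp add: prob_dists_ge1_def prob_dists_def)
  have int: "integrable M (\<lambda>x. (x / c) ^ k)"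
    if "M \<in> finite_moment_dists" for M and k :: nat
  proof -
    interpret M: real_distribution M
      using that by (simp add: finite_moment_dists_def prob_dists_def)
    have "integrable M (\<lambda>x. \<bar>x\<bar> ^ k)"
      using that by (simp add: finite_moment_dists_def)
    then have "integrable M (\<lambda>x. x ^ k)"
      by (rule Bochner_Integration.integrable_bound) (auto simp: power_abs)
    then show ?thesis by (simp add: power_divide)
  qed
  have intP: "integrable P (\<lambda>x. (x / c) ^ k)" and intQ: "integrable Q (\<lambda>x. (x / c) ^ k)" for k
    using int P Q by auto
  have geP: "AE x in P. 1 \<le> x"
    using P.AE_in_supp_discrete[OF P(2)] P(1)
    by (auto simp: prob_dists_ge1_def elim: eventually_mono)
  have geQ: "AE x in Q. 1 \<le> x"
    using Q.AE_in_supp_discrete[OF Q(2)] Q(1)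
    by (auto simp: prob_dists_ge1_def elim: eventually_mono)
  have "\<forall>\<^sub>F k in sequentially. (\<integral>x. indicator {..<c} x * (x / c) ^ k \<partial>P)
      < measure Q {c} - measure P {c}"
    using P.power_integral_below_tendsto_0[OF geP c] less by (intro order_tendstoD) auto
  then show ?thesis
  proof eventually_elim
    case (elim k)
    \<comment> \<open>For \<open>Q\<close> the part below \<open>c\<close> helps the inequality, so
      its sign suffices and no limit is taken.\<close>
    have "0 \<le> (\<integral>x. indicator {..<c} x * (x / c) ^ k \<partial>Q)"
      using geQ c by (intro integral_nonneg_AE) (auto elim!: eventually_mono)
    moreover have "(\<integral>x. indicator {c<..} x * (x / c) ^ k \<partial>P)
        \<le> (\<integral>x. indicator {c<..} x * (x / c) ^ k \<partial>Q)"
      using P.real_distribution_axioms Q.real_distribution_axioms P(2) intQ c le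
      by (rule power_integral_above_le)
    ultimately have "(\<integral>x. (x / c) ^ k \<partial>P) < (\<integral>x. (x / c) ^ k \<partial>Q)"
      using elim P.integral_power_split[OF intP c, of k] Q.integral_power_split[OF intQ c, of k]
      by linarith
    \<comment> \<open>Multiplying by \<open>c ^ k > 0\<close> turns the scaled integrals back into
      moments.\<close>
    then show ?case
      using c by (simp add: moment_def power_divide divide_less_cancel)
  qed
qed

lemma tail_lessI:
  fixes P Q :: "real measure"
  assumes P: "P \<in> prob_dists_ge1 \<inter> finite_moment_dists" "discrete_dist P"
    and Q: "Q \<in> prob_dists_ge1 \<inter> finite_moment_dists" "discrete_dist Q"
    and c: "0 < c" and less: "measure P {c} < measure Q {c}"
    and le: "\<And>x. c < x \<Longrightarrow> measure P {x} \<le> measure Q {x}"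
  shows "tail_less P Q"
proof -
  have ev: "\<forall>\<^sub>F k in sequentially. moment k P < moment k Q"
    by (rule moment_eventually_less) fact+
  then have "MOST k. moment k P \<le> moment k Q"
    unfolding cofinite_eq_sequentially by eventually_elim simp
  then have "tail_le P Q"
    using P Q by (simp add: tail_le_def)
  moreover have "\<not> tail_le Q P"
  proof
    assume "tail_le Q P"
    \<comment> \<open>The alternative \<open>Q = P\<close> in \<open>tail_le\<close> is ruled out by
      the different masses at \<open>c\<close>.\<close>
    then have "\<forall>\<^sub>F k in sequentially. moment k Q \<le> moment k P"
      using less by (auto simp: tail_le_def cofinite_eq_sequentially)
    then have "\<forall>\<^sub>F k::nat in sequentially. False"
      using ev by eventually_elim simp
    then show False by simp
  qed
  ultimately show ?thesis by (simp add: tail_less_def)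
qed

theorem theorem4p18:
  fixes P1 P2 :: "real measure" and f g :: "real \<Rightarrow> real"
  assumes "P1 \<in> prob_dists_ge1 \<inter> finite_moment_dists"
    and "P2 \<in> prob_dists_ge1 \<inter> finite_moment_dists"
    and "discrete_dist P1" and "discrete_dist P2"
    and "\<And>x. f x = measure P1 {x}" and "\<And>x. g x = measure P2 {x}"
  shows "((\<exists>x0\<ge>1. f x0 < g x0 \<and> (\<forall>x>x0. f x \<le> g x)) \<longrightarrow> tail_less P1 P2) \<and>
    (finite (supp P1) \<and> finite (supp P2) \<longrightarrow>
      (tail_less P1 P2 \<longleftrightarrow> (\<exists>x0\<ge>1. f x0 < g x0 \<and> (\<forall>x>x0. f x \<le> g x))))"
proof -
  interpret P1: real_distribution P1
    using assms by (simp add: prob_dists_ge1_def prob_dists_def)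
  interpret P2: real_distribution P2
    using assms by (simp add: prob_dists_ge1_def prob_dists_def)
  have 1: "tail_less P1 P2" if "\<exists>x0\<ge>1. f x0 < g x0 \<and> (\<forall>x>x0. f x \<le> g x)"
  proof -
    from that obtain x0 where "1 \<le> x0" "f x0 < g x0" "\<forall>x>x0. f x \<le> g x"
      by blast
    then show ?thesis
      using assms by (intro tail_lessI[of P1 P2 x0]) auto
  qed
  have 2: "\<exists>x0\<ge>1. f x0 < g x0 \<and> (\<forall>x>x0. f x \<le> g x)"
    if fin: "finite (supp P1)" "finite (supp P2)" and less: "tail_less P1 P2"
  proof -
    define D where "D = {x. f x \<noteq> g x}"
    have D: "D \<subseteq> supp P1 \<union> supp P2"
    proof
      fix x assume "x \<in> D"
      then have "measure P1 {x} \<noteq> 0 \<or> measure P2 {x} \<noteq> 0"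
        using assms(5,6) by (auto simp: D_def)
      then show "x \<in> supp P1 \<union> supp P2"
        using P1.atom_in_supp P2.atom_in_supp by blast
    qed
    then have "finite D"
      using fin by (meson finite_UnI finite_subset)
    \<comment> \<open>Without a differing atom the two discrete measures would coincide, but
      \<open>tail_less\<close> is irreflexive.\<close>
    have "D \<noteq> {}"
    proof
      assume "D = {}"
      then have "measure P1 {x} = measure P2 {x}" for x
        using assms(5,6) by (auto simp: D_def)
      then have "P1 = P2"
        using assms P1.real_distribution_axioms P2.real_distribution_axioms
        by (intro discrete_dist_eqI)
      then show False
        using less by (simp add: tail_less_def)
    qed
    \<comment> \<open>The witness is the largest point of disagreement: above it \<open>f\<close>
      and \<open>g\<close> are equal, and it is at least 1 because it lies in one of the
      supports.\<close>
    define x0 where "x0 = Max D"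
    have x0: "x0 \<in> D"
      unfolding x0_def using \<open>finite D\<close> \<open>D \<noteq> {}\<close> by (rule Max_in)
    then have "1 \<le> x0"
      using D assms(1,2) by (auto simp: prob_dists_ge1_def)
    have above: "f x = g x" if "x0 < x" for x
    proof -
      have "x \<notin> D"
        using that \<open>finite D\<close> unfolding x0_def by (meson Max_ge leD)
      then show ?thesis by (simp add: D_def)
    qed
    \<comment> \<open>Otherwise the sufficient condition with the roles of \<open>P1\<close> and
      \<open>P2\<close> exchanged would give the opposite strict order.\<close>
    have "\<not> g x0 < f x0"
    proof
      assume "g x0 < f x0"
      then have "tail_less P2 P1"
        using assms above \<open>1 \<le> x0\<close> by (intro tail_lessI[of P2 P1 x0]) auto
      then show False
        using less by (simp add: tail_less_def)
    qed
    then have "f x0 < g x0"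
      using x0 by (auto simp: D_def)
    then show ?thesis
      using \<open>1 \<le> x0\<close> above by (intro exI[of _ x0]) auto
  qed
  from 1 2 show ?thesis by blast
qed

end
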